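(* Let $B$ be a Banach space, $D\subseteq B$ a nonempty closed convex subset, and $T:D\to D$ a weak-contraction map, i.e. there exist constants $\delta\in(0,1)$ and $L\ge 0$ such that $\|Tx-Ty\|\le \delta\|x-y\|+L\|y-Ty\|$ for all $x,y\in D$. Assume that the set $F_T$ of fixed points of $T$ is nonempty and let $u^\ast\in F_T$. Let $\{a_n^i\}_{n=0}^\infty\subset[0,1]$, $i\in\{0,1,2\}$, be real sequences satisfying, for each $i\in\{0,1,2\}$, (i) $0\le a_n^i<\frac{1}{1+\delta}$ for all $n\in\mathbb{N}$, and (ii) $\lim_{n\to\infty}a_n^i=0$. Let $\{\omega_n\}_{n=0}^\infty$, $\{q_n\}_{n=0}^\infty$ and $\{x_n\}_{n=0}^\infty$ be the Noor, SP and Picard-S iterative sequences of $T$, respectively, with these parameters and with the same initial point $\omega_0=q_0=x_0\in D$, $x_0\ne u^\ast$. Then $u^\ast$ is the unique fixed point of $T$, $\{x_n\}$ converges to $u^\ast$, and $\{x_n\}$ converges faster to $u^\ast$ than both $\{\omega_n\}$ and $\{q_n\}$, that is, $$\lim_{n\to\infty}\frac{\|x_n-u^\ast\|}{\|\omega_n-u^\ast\|}=0\qquad\text{and}\qquad \lim_{n\to\infty}\frac{\|x_n-u^\ast\|}{\|q_n-u^\ast\|}=0.$$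
   Context: $\mathbb{N}$ denotes the set of nonnegative integers. $F_T=\{x\in D: Tx=x\}$. Noor iteration (initial point $\omega_0\in D$), for $n\in\mathbb{N}$: $$\rho_n=(1-a_n^2)\omega_n+a_n^2T\omega_n,\qquad \varpi_n=(1-a_n^1)\omega_n+a_n^1T\rho_n,\qquad \omega_{n+1}=(1-a_n^0)\omega_n+a_n^0T\varpi_n.$$ SP iteration (initial point $q_0\in D$), for $n\in\mathbb{N}$: $$s_n=(1-a_n^2)q_n+a_n^2Tq_n,\qquad r_n=(1-a_n^1)s_n+a_n^1Ts_n,\qquad q_{n+1}=(1-a_n^0)r_n+a_n^0Tr_n.$$ Picard-S iteration (initial point $x_0\in D$), for $n\in\mathbb{N}$: $$z_n=(1-a_n^2)x_n+a_n^2Tx_n,\qquad y_n=(1-a_n^1)Tx_n+a_n^1Tz_n,\qquad x_{n+1}=Ty_n.$$ *)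

theory Defs
  imports "HOL-Analysis.Analysis"
begin

definition weak_contraction_on :: "'a::real_normed_vector set \<Rightarrow> ('a \<Rightarrow> 'a) \<Rightarrow> real \<Rightarrow> real \<Rightarrow> bool" where
  "weak_contraction_on D T \<delta> L \<longleftrightarrow>
     T \<in> D \<rightarrow> D \<and> 0 < \<delta> \<and> \<delta> < 1 \<and> 0 \<le> L \<and>
     (\<forall>x\<in>D. \<forall>y\<in>D. norm (T x - T y) \<le> \<delta> * norm (x - y) + L * norm (y - T y))"

definition fixed_points :: "'a set \<Rightarrow> ('a \<Rightarrow> 'a) \<Rightarrow> 'a set" where
  "fixed_points D T = {x \<in> D. T x = x}"

text \<open>In the iterations below, the parameter \<open>a i n\<close> stands for \<open>a\<^sub>n\<^sup>i\<close>: the first argument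
  is the upper index \<open>i \<in> {0, 1, 2}\<close>, the second one the step \<open>n\<close>.\<close>

primrec noor :: "('a::real_vector \<Rightarrow> 'a) \<Rightarrow> (nat \<Rightarrow> nat \<Rightarrow> real) \<Rightarrow> 'a \<Rightarrow> nat \<Rightarrow> 'a" where
  "noor T a w0 0 = w0"
| "noor T a w0 (Suc n) =
     (let w = noor T a w0 n;
          \<rho> = (1 - a 2 n) *\<^sub>R w + a 2 n *\<^sub>R T w;
          v = (1 - a 1 n) *\<^sub>R w + a 1 n *\<^sub>R T \<rho>
      in (1 - a 0 n) *\<^sub>R w + a 0 n *\<^sub>R T v)"

primrec sp :: "('a::real_vector \<Rightarrow> 'a) \<Rightarrow> (nat \<Rightarrow> nat \<Rightarrow> real) \<Rightarrow> 'a \<Rightarrow> nat \<Rightarrow> 'a" where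
  "sp T a q0 0 = q0"
| "sp T a q0 (Suc n) =
     (let q = sp T a q0 n;
          s = (1 - a 2 n) *\<^sub>R q + a 2 n *\<^sub>R T q;
          r = (1 - a 1 n) *\<^sub>R s + a 1 n *\<^sub>R T s
      in (1 - a 0 n) *\<^sub>R r + a 0 n *\<^sub>R T r)"

primrec picard_s :: "('a::real_vector \<Rightarrow> 'a) \<Rightarrow> (nat \<Rightarrow> nat \<Rightarrow> real) \<Rightarrow> 'a \<Rightarrow> nat \<Rightarrow> 'a" where
  "picard_s T a x0 0 = x0"
| "picard_s T a x0 (Suc n) =
     (let x = picard_s T a x0 n;
          z = (1 - a 2 n) *\<^sub>R x + a 2 n *\<^sub>R T x;
          y = (1 - a 1 n) *\<^sub>R T x + a 1 n *\<^sub>R T z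
      in T y)"

end

(* Taking y = u in the weak-contraction inequality gives ||T x - u|| <= delta ||x - u||. Hence each
   Picard-S step multiplies the distance to u by at most delta^2, whereas a Noor (or SP)
   step retains at least the fraction 1 - a0 (1 + delta) (or the product of three such factors) of
   it. These fractions are positive and tend to 1, so the ratio of the distances is eventually
   dominated by a geometric sequence. *)
theory Submission
  imports Defs
begin

text \<open>Successive quotients satisfy
  \<open>e (Suc n) / f (Suc n) \<le> (k / c n) * (e n / f n)\<close>, and \<open>k / c n\<close>
  tends to \<open>k < 1\<close>. So a fixed loss in the numerator beats a loss in the denominator
  that fades out.\<close>

lemma ratio_tendsto_zero:
  fixes e f c :: "nat \<Rightarrow> real"
  assumes "k < 1" and "\<And>n. 0 \<le> e n" and e: "\<And>n. e (Suc n) \<le> k * e n"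
    and "0 < f 0" and c: "\<And>n. 0 < c n" and f: "\<And>n. c n * f n \<le> f (Suc n)"
    and "c \<longlonglongrightarrow> 1"
  shows "(\<lambda>n. e n / f n) \<longlonglongrightarrow> 0"
proof -
  \<comment> \<open>The denominators never vanish, so the convention \<open>x / 0 = 0\<close> plays
    no part in the limit.\<close>
  have fpos: "0 < f n" for n
  proof (induction n)
    case (Suc n)
    then show ?case using f[of n] c[of n] by (meson less_le_trans mult_pos_pos)
  qed fact
  have "(\<lambda>n. k / c n) \<longlonglongrightarrow> k / 1"
    by (intro tendsto_divide tendsto_const \<open>c \<longlonglongrightarrow> 1\<close>) simp
  \<comment> \<open>The factors \<open>k / c n\<close> may exceed \<open>k\<close> for every
    \<open>n\<close>; a bound strictly between \<open>k\<close> and 1 leaves the room needed to hold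
    from some index on.\<close>
  moreover obtain m where m: "k < m" "m < 1" using dense[OF \<open>k < 1\<close>] by blast
  ultimately have "eventually (\<lambda>n. k / c n < m) sequentially"
    by (intro order_tendstoD(2)[where y = k]) auto
  then obtain N where N: "\<And>n. n \<ge> N \<Longrightarrow> k / c n < m"
    by (auto simp: eventually_sequentially)
  have "norm (e (Suc n) / f (Suc n)) \<le> m * norm (e n / f n)" if "N \<le> n" for n
  proof -
    have "e (Suc n) / f (Suc n) \<le> e (Suc n) / (c n * f n)"
      using assms(2) f c fpos by (intro divide_left_mono) auto
    also have "\<dots> \<le> (k * e n) / (c n * f n)"
      using e c[of n] fpos[of n] by (intro divide_right_mono) auto
    also have "\<dots> = k / c n * (e n / f n)" by simp
    also have "\<dots> \<le> m * (e n / f n)"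
      using N[OF that] assms(2)[of n] fpos[of n] by (intro mult_right_mono) auto
    finally show ?thesis using assms(2) fpos by (simp add: less_imp_le)
  qed
  then have "summable (\<lambda>n. e n / f n)" using m(2) by (intro summable_ratio_test)
  then show ?thesis by (rule summable_LIMSEQ_zero)
qed

text \<open>Isolates what the step estimates use: distances to the single point \<open>u\<close>
  shrink, while distances between arbitrary points need not.\<close>

locale contraction_towards =
  fixes D :: "'a::real_normed_vector set" and T :: "'a \<Rightarrow> 'a" and u :: 'a and \<delta> :: real
  assumes convex: "convex D" and maps: "x \<in> D \<Longrightarrow> T x \<in> D"
    and delta: "0 < \<delta>" "\<delta> < 1"
    and contr: "x \<in> D \<Longrightarrow> norm (T x - u) \<le> \<delta> * norm (x - u)"
begin

lemma comb_in: "x \<in> D \<Longrightarrow> y \<in> D \<Longrightarrow> t \<in> {0..1} \<Longrightarrow> (1 - t) *\<^sub>R x + t *\<^sub>R y \<in> D"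
  using convex by (simp add: convexD)

lemma norm_contr_le: "x \<in> D \<Longrightarrow> norm (T x - u) \<le> norm (x - u)"
  by (metis contr delta(2) less_imp_le mult_left_le_one_le norm_ge_zero delta(1) order_trans)

lemma comb_diff:
  "(1 - t) *\<^sub>R x + t *\<^sub>R y - u = (1 - t) *\<^sub>R (x - u) + t *\<^sub>R (y - u)"
  by (simp add: algebra_simps)

text \<open>Closed balls around \<open>u\<close> are convex. This yields the upper bounds for all
  intermediate points.\<close>

lemma comb_le:
  assumes "t \<in> {0..1}" "norm (x - u) \<le> r" "norm (y - u) \<le> r"
  shows "norm ((1 - t) *\<^sub>R x + t *\<^sub>R y - u) \<le> r"
  using convexD_alt[OF convex_cball, of x u r y t] assms
  by (simp add: dist_norm norm_minus_commute)

text \<open>By the reverse triangle inequality the norm is at least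
  \<open>(1 - t) * norm (x - u) - t * norm (T y - u)\<close>, and the last norm is at most
  \<open>\<delta> * norm (x - u)\<close>. The point \<open>y\<close> is kept apart from
  \<open>x\<close> for the Noor step, where \<open>T\<close> acts on an auxiliary point; the SP
  steps take \<open>y = x\<close>.\<close>

lemma comb_ge:
  assumes "t \<in> {0..1}" "y \<in> D" "norm (y - u) \<le> norm (x - u)"
  shows "(1 - t * (1 + \<delta>)) * norm (x - u) \<le> norm ((1 - t) *\<^sub>R x + t *\<^sub>R T y - u)"
proof -
  have "norm (T y - u) \<le> \<delta> * norm (x - u)"
    using contr[OF assms(2)] assms(3) delta by (meson less_imp_le mult_left_mono order_trans)
  then have "t * norm (T y - u) \<le> t * (\<delta> * norm (x - u))"
    using assms(1) by (intro mult_left_mono) auto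
  moreover have "(1 - t) * norm (x - u) - t * norm (T y - u)
      \<le> norm ((1 - t) *\<^sub>R (x - u) + t *\<^sub>R (T y - u))"
    using norm_diff_ineq[of "(1 - t) *\<^sub>R (x - u)" "t *\<^sub>R (T y - u)"] assms(1) by simp
  ultimately show ?thesis unfolding comb_diff by (simp add: algebra_simps)
qed

context
  fixes a :: "nat \<Rightarrow> nat \<Rightarrow> real"
  assumes a: "\<And>i n. i \<in> {0, 1, 2} \<Longrightarrow> a i n \<in> {0..1}"
begin

lemma a_mem: "a 0 n \<in> {0..1}" "a 1 n \<in> {0..1}" "a 2 n \<in> {0..1}"
  by (rule a; simp)+

lemma picard_s_in: "x \<in> D \<Longrightarrow> picard_s T a x n \<in> D"
  by (induction n) (simp_all add: Let_def comb_in maps a_mem[unfolded One_nat_def] del: atLeastAtMost_iff)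

lemma noor_in: "x \<in> D \<Longrightarrow> noor T a x n \<in> D"
  by (induction n) (simp_all add: Let_def comb_in maps a_mem[unfolded One_nat_def] del: atLeastAtMost_iff)

lemma sp_in: "x \<in> D \<Longrightarrow> sp T a x n \<in> D"
  by (induction n) (simp_all add: Let_def comb_in maps a_mem[unfolded One_nat_def] del: atLeastAtMost_iff)

text \<open>One factor \<delta> comes from the outer \<open>T\<close> in \<open>T y\<close>. The
  other arises because \<open>y\<close> averages \<open>T x\<close> and \<open>T z\<close>, both
  within \<open>\<delta> * norm (x - u)\<close> of \<open>u\<close>.\<close>

lemma picard_s_step:
  assumes "x0 \<in> D"
  shows "norm (picard_s T a x0 (Suc n) - u) \<le> \<delta>\<^sup>2 * norm (picard_s T a x0 n - u)"
proof -
  define x where "x = picard_s T a x0 n"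
  define z where "z = (1 - a 2 n) *\<^sub>R x + a 2 n *\<^sub>R T x"
  define y where "y = (1 - a 1 n) *\<^sub>R T x + a 1 n *\<^sub>R T z"
  have x: "x \<in> D" using picard_s_in[OF assms] by (simp add: x_def)
  then have z: "z \<in> D" unfolding z_def by (intro comb_in maps a_mem)
  then have y: "y \<in> D" unfolding y_def by (intro comb_in maps a_mem x)
  have "norm (z - u) \<le> norm (x - u)"
    unfolding z_def by (intro comb_le a_mem norm_contr_le x order_refl)
  then have "norm (T z - u) \<le> \<delta> * norm (x - u)"
    using contr[OF z] delta by (meson less_imp_le mult_left_mono order_trans)
  then have "norm (y - u) \<le> \<delta> * norm (x - u)"
    unfolding y_def by (intro comb_le a_mem contr x)
  then have "norm (T y - u) \<le> \<delta> * (\<delta> * norm (x - u))"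
    using contr[OF y] delta by (meson less_imp_le mult_left_mono order_trans)
  then show ?thesis
    by (simp add: Let_def x_def y_def z_def power2_eq_square mult.assoc)
qed

text \<open>Only \<open>a 0 n\<close> appears: the inner averages matter only through the upper
  bound \<open>norm (v - u) \<le> norm (w - u)\<close>, after which \<open>comb_ge\<close> applies
  to the outermost average.\<close>

lemma noor_step:
  assumes "x0 \<in> D"
  shows "(1 - a 0 n * (1 + \<delta>)) * norm (noor T a x0 n - u) \<le> norm (noor T a x0 (Suc n) - u)"
proof -
  define w where "w = noor T a x0 n"
  define p where "p = (1 - a 2 n) *\<^sub>R w + a 2 n *\<^sub>R T w"
  define v where "v = (1 - a 1 n) *\<^sub>R w + a 1 n *\<^sub>R T p"
  have w: "w \<in> D" using noor_in[OF assms] by (simp add: w_def)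
  then have p: "p \<in> D" unfolding p_def by (intro comb_in maps a_mem)
  then have v: "v \<in> D" unfolding v_def by (intro comb_in maps a_mem w)
  have "norm (p - u) \<le> norm (w - u)"
    unfolding p_def by (intro comb_le a_mem norm_contr_le w order_refl)
  then have "norm (T p - u) \<le> norm (w - u)"
    using norm_contr_le[OF p] by linarith
  then have "norm (v - u) \<le> norm (w - u)"
    unfolding v_def by (intro comb_le a_mem order_refl)
  from comb_ge[OF a_mem(1) v this] show ?thesis
    by (simp add: Let_def w_def v_def p_def)
qed

text \<open>Each of the three substeps averages a point with its own image, so
  \<open>comb_ge\<close> costs one factor per substep. Positivity of the factors allows the lower
  bounds to be chained.\<close>

lemma sp_step:
  assumes "x0 \<in> D" and pos: "\<And>i. i \<in> {0, 1, 2} \<Longrightarrow> 0 < 1 - a i n * (1 + \<delta>)"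
  shows "(1 - a 0 n * (1 + \<delta>)) * ((1 - a 1 n * (1 + \<delta>)) * (1 - a 2 n * (1 + \<delta>)))
      * norm (sp T a x0 n - u) \<le> norm (sp T a x0 (Suc n) - u)"
proof -
  define q where "q = sp T a x0 n"
  define s where "s = (1 - a 2 n) *\<^sub>R q + a 2 n *\<^sub>R T q"
  define r where "r = (1 - a 1 n) *\<^sub>R s + a 1 n *\<^sub>R T s"
  define b where "b i = 1 - a i n * (1 + \<delta>)" for i
  have b: "0 \<le> b 0" "0 \<le> b 1" using pos[of 0] pos[of 1] by (simp_all add: b_def)
  have q: "q \<in> D" using sp_in[OF assms(1)] by (simp add: q_def)
  then have s: "s \<in> D" unfolding s_def by (intro comb_in maps a_mem)
  then have r: "r \<in> D" unfolding r_def by (intro comb_in maps a_mem)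
  have 2: "b 2 * norm (q - u) \<le> norm (s - u)"
    unfolding s_def b_def by (intro comb_ge a_mem q order_refl)
  have 1: "b 1 * norm (s - u) \<le> norm (r - u)"
    unfolding r_def b_def by (intro comb_ge a_mem s order_refl)
  have "b 0 * norm (r - u) \<le> norm ((1 - a 0 n) *\<^sub>R r + a 0 n *\<^sub>R T r - u)"
    unfolding b_def by (intro comb_ge a_mem r order_refl)
  moreover have "b 0 * (b 1 * (b 2 * norm (q - u))) \<le> b 0 * norm (r - u)"
    using 1 2 b by (meson mult_left_mono order_trans)
  ultimately show ?thesis
    by (simp add: Let_def q_def s_def r_def b_def mult.assoc)
qed

end

end

text \<open>The weak-contraction inequality is not symmetric: the fixed point must be its second
  argument, so that the term with \<open>L\<close> vanishes.\<close>

lemma weak_contraction_fixed_point: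
  assumes "weak_contraction_on D T \<delta> L" "u \<in> fixed_points D T" "x \<in> D"
  shows "norm (T x - u) \<le> \<delta> * norm (x - u)"
proof -
  have "norm (T x - T u) \<le> \<delta> * norm (x - u) + L * norm (u - T u)"
    using assms unfolding weak_contraction_on_def fixed_points_def by blast
  then show ?thesis using assms(2) by (simp add: fixed_points_def)
qed

theorem theorem3:
  fixes D :: "'a::banach set" and T :: "'a \<Rightarrow> 'a" and \<delta> L :: real
    and a :: "nat \<Rightarrow> nat \<Rightarrow> real" and u x0 :: 'a
  assumes "D \<noteq> {}" and "closed D" and "convex D"
    and "weak_contraction_on D T \<delta> L"
    and "u \<in> fixed_points D T"
    and "\<And>i n. i \<in> {0, 1, 2} \<Longrightarrow> a i n \<in> {0..1}"
    and "\<And>i n. i \<in> {0, 1, 2} \<Longrightarrow> 0 \<le> a i n \<and> a i n < 1 / (1 + \<delta>)"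
    and "\<And>i. i \<in> {0, 1, 2} \<Longrightarrow> (\<lambda>n. a i n) \<longlonglongrightarrow> 0"
    and "x0 \<in> D" and "x0 \<noteq> u"
  shows "fixed_points D T = {u} \<and>
    picard_s T a x0 \<longlonglongrightarrow> u \<and>
    (\<lambda>n. norm (picard_s T a x0 n - u) / norm (noor T a x0 n - u)) \<longlonglongrightarrow> 0 \<and>
    (\<lambda>n. norm (picard_s T a x0 n - u) / norm (sp T a x0 n - u)) \<longlonglongrightarrow> 0"
proof (intro conjI)
  have delta: "0 < \<delta>" "\<delta> < 1" using assms(4) by (auto simp: weak_contraction_on_def)
  interpret contraction_towards D T u \<delta>
  proof
    show "T x \<in> D" if "x \<in> D" for x
      using assms(4) that by (auto simp: weak_contraction_on_def)
  qed (use delta assms(3) weak_contraction_fixed_point[OF assms(4,5)] in auto)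
  show "fixed_points D T = {u}"
  proof -
    have "x = u" if "x \<in> fixed_points D T" for x
    proof (rule ccontr)
      assume "x \<noteq> u"
      \<comment> \<open>A second fixed point would have
        \<open>norm (x - u) = norm (T x - u)\<close>, which \<open>contr\<close> bounds by this
        strictly smaller number.\<close>
      then have "\<delta> * norm (x - u) < norm (x - u)" using delta by simp
      then show False using contr[of x] that by (simp add: fixed_points_def)
    qed
    then show ?thesis using assms(5) by blast
  qed
  define e where "e n = norm (picard_s T a x0 n - u)" for n
  define c where "c i n = 1 - a i n * (1 + \<delta>)" for i n
  \<comment> \<open>The bound \<open>a i n < 1 / (1 + \<delta>)\<close> says exactly that this
    factor is positive.\<close>
  have c_pos: "0 < c i n" if "i \<in> {0, 1, 2}" for i n
    using assms(7)[OF that, of n] delta by (simp add: c_def pos_less_divide_eq)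
  have c_lim: "c i \<longlonglongrightarrow> 1" if "i \<in> {0, 1, 2}" for i
    unfolding c_def using tendsto_diff[OF tendsto_const tendsto_mult_left_zero[OF assms(8)[OF that]], of 1]
    by simp
  have k: "\<delta>\<^sup>2 < 1" using delta by (simp add: power_less_one_iff)
  have e: "0 \<le> e n" "e (Suc n) \<le> \<delta>\<^sup>2 * e n" for n
    unfolding e_def using picard_s_step[OF assms(6,9)] by simp_all
  \<comment> \<open>Plain convergence is the case of a constant denominator.\<close>
  have "(\<lambda>n. e n / 1) \<longlonglongrightarrow> 0"
    by (rule ratio_tendsto_zero[where e = e and f = "\<lambda>_. 1" and c = "\<lambda>_. 1", OF k e]) simp_all
  then show "picard_s T a x0 \<longlonglongrightarrow> u"
    by (simp add: e_def LIM_zero_iff tendsto_norm_zero_iff)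
  show "(\<lambda>n. norm (picard_s T a x0 n - u) / norm (noor T a x0 n - u)) \<longlonglongrightarrow> 0"
    unfolding e_def[symmetric]
  \<comment> \<open>The initial denominator is \<open>norm (x0 - u)\<close>, positive since
    \<open>x0 \<noteq> u\<close>.\<close>
  proof (rule ratio_tendsto_zero[where e = e and c = "c 0", OF k e])
    show "c 0 n * norm (noor T a x0 n - u) \<le> norm (noor T a x0 (Suc n) - u)" for n
      unfolding c_def by (rule noor_step[OF assms(6,9)])
  qed (use c_pos c_lim assms(10) in auto)
  show "(\<lambda>n. norm (picard_s T a x0 n - u) / norm (sp T a x0 n - u)) \<longlonglongrightarrow> 0"
    unfolding e_def[symmetric]
  proof (rule ratio_tendsto_zero[where e = e and c = "\<lambda>n. c 0 n * (c 1 n * c 2 n)", OF k e])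
    show "c 0 n * (c 1 n * c 2 n) * norm (sp T a x0 n - u) \<le> norm (sp T a x0 (Suc n) - u)" for n
      unfolding c_def by (rule sp_step[OF assms(6,9)]) (use c_pos in \<open>auto simp: c_def\<close>)
    show "(\<lambda>n. c 0 n * (c 1 n * c 2 n)) \<longlonglongrightarrow> 1"
      using tendsto_mult[OF c_lim[of 0] tendsto_mult[OF c_lim[of 1] c_lim[of 2]]] by simp
  qed (use c_pos assms(10) in auto)
qed

end
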